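(* For all $n,k\ge 1$, the sequence $D(n,k)$ is an $(n,k)$-De Bruijn sequence.
   Context: Words are finite sequences of symbols from $[k]=\{0,1,\dots,k-1\}$; $\sigma^t$ denotes $t$ repetitions of $\sigma$ ($\sigma^0$ is the empty word), $|w|$ is the length of $w$. A rotation of a word $xy$ is the word $yx$. For words of equal length, $w_1\le_{\mathrm{colex}} w_2$ means that the reversal of $w_1$ is lexicographically $\le$ the reversal of $w_2$; equivalently $w_1=w_2$, or $w_1=y_1\sigma x$ and $w_2=y_2\tau x$ with symbols $\sigma<\tau$. Fix $n\ge1$. A key-word is a word of length $n$ that is $\le_{\mathrm{colex}}$-maximal among its rotations. Let $c(n,k)$ be the number of key-words in $[k]^n$, and list them in increasing colex order $\mathrm{key}_0<_{\mathrm{colex}}\mathrm{key}_1<_{\mathrm{colex}}\cdots<_{\mathrm{colex}}\mathrm{key}_{c(n,k)-1}$ (so $\mathrm{key}_0=0^n$). Cycles: $C_0=(0^n)$ and $\mathrm{first}(C_0)=\mathrm{last}(C_0)=\mathrm{key}(C_0)=0^n$. For $m\ge1$ write $\mathrm{key}_m=0^l(\sigma+1)w$ with $l\ge0$ and $\sigma$ a symbol; $C_m$ is the sequence of all distinct rotations of $\mathrm{key}_m$ which starts with $\mathrm{first}(C_m)=w0^l(\sigma+1)$, in which each word $\tau w'$ ($\tau$ a symbol) is followed by $w'\tau$, and which ends with $\mathrm{last}(C_m)=(\sigma+1)w0^l$; also $\mathrm{key}(C_m)=\mathrm{key}_m$. Construction: $D_0=(0^n)$; for $0\le m<c(n,k)-1$,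 writing $\mathrm{key}_{m+1}=0^l(\sigma+1)w$, the sequence $D_{m+1}$ is obtained from $D_m$ by inserting the whole sequence $C_{m+1}$ (in its order) immediately after the word $\sigma w0^l$ (which already occurs in $D_m$). Set $D(n,k)=D_{c(n,k)-1}$. An $(n,k)$-De Bruijn sequence is a total ordering (listing) of all of $[k]^n$ such that (1) every word of the form $\tau w$ ($\tau$ a symbol) that is not last is immediately followed by a word of the form $w\sigma$, and (2) if the last word is $\tau x$ then the first word is of the form $x\sigma$. *)

theory Defs
  imports Main
begin

text \<open>Words over the alphabet \<open>{0, ..., k - 1}\<close> are lists of natural numbers; lists of words
  represent sequences of words.\<close>

definition words :: "nat \<Rightarrow> nat \<Rightarrow> nat list set" where
  "words n k = {w. length w = n \<and> set w \<subseteq> {..<k}}"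

definition rotations :: "'a list \<Rightarrow> 'a list set" where
  "rotations w = {y @ x | x y. w = x @ y}"

definition colex_less :: "nat list \<Rightarrow> nat list \<Rightarrow> bool" where
  "colex_less u v \<longleftrightarrow> (rev u, rev v) \<in> lexord less_than"

definition colex_le :: "nat list \<Rightarrow> nat list \<Rightarrow> bool" where
  "colex_le u v \<longleftrightarrow> u = v \<or> colex_less u v"

definition key_words :: "nat \<Rightarrow> nat \<Rightarrow> nat list set" where
  "key_words n k = {w \<in> words n k. \<forall>v \<in> rotations w. colex_le v w}"

definition num_keys :: "nat \<Rightarrow> nat \<Rightarrow> nat" where
  "num_keys n k = card (key_words n k)"

text \<open>The list below exists and is unique, see \<open>keys_ex1\<close>.\<close>

definition keys :: "nat \<Rightarrow> nat \<Rightarrow> nat list list" where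
  "keys n k = (THE ks. sorted_wrt colex_less ks \<and> set ks = key_words n k)"

definition key :: "nat \<Rightarrow> nat \<Rightarrow> nat \<Rightarrow> nat list" where
  "key n k m = keys n k ! m"

definition leading_zeros :: "nat list \<Rightarrow> nat" where
  "leading_zeros u = length (takeWhile ((=) 0) u)"

text \<open>The next two functions read a word that is not all zeros as \<open>0\<^sup>l (\<sigma> + 1) w\<close>
  (\<open>decomposition\<close> below). The first gives \<open>w 0\<^sup>l (\<sigma> + 1)\<close>, where the cycle of the word starts;
  the second gives \<open>\<sigma> w 0\<^sup>l\<close>, after which that cycle gets inserted. The value of the second one on
  an all-zero word is irrelevant.\<close>

definition first_of :: "nat list \<Rightarrow> nat list" where
  "first_of u = (case dropWhile ((=) 0) u of
     Suc \<sigma> # w \<Rightarrow> w @ replicate (leading_zeros u) 0 @ [Suc \<sigma>]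
   | _ \<Rightarrow> u)"

definition attach_of :: "nat list \<Rightarrow> nat list" where
  "attach_of u = (case dropWhile ((=) 0) u of
     Suc \<sigma> # w \<Rightarrow> \<sigma> # w @ replicate (leading_zeros u) 0
   | _ \<Rightarrow> u)"

text \<open>A word \<open>\<tau> w\<close> is followed by \<open>w \<tau>\<close>, its image under \<^const>\<open>rotate1\<close>; the listing stops once
  all distinct rotations have been produced (see \<open>cycle_of_correct\<close>).\<close>

definition cycle_of :: "nat list \<Rightarrow> nat list list" where
  "cycle_of u = map (\<lambda>i. rotate i (first_of u)) [0..<card (rotations u)]"

fun insert_after :: "'a \<Rightarrow> 'a list \<Rightarrow> 'a list \<Rightarrow> 'a list" where
  "insert_after x ys [] = []"
| "insert_after x ys (z # zs) = (if z = x then z # ys @ zs else z # insert_after x ys zs)"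

primrec D_stage :: "nat \<Rightarrow> nat \<Rightarrow> nat \<Rightarrow> nat list list" where
  "D_stage n k 0 = [replicate n 0]"
| "D_stage n k (Suc m) =
     insert_after (attach_of (key n k (Suc m))) (cycle_of (key n k (Suc m))) (D_stage n k m)"

definition D :: "nat \<Rightarrow> nat \<Rightarrow> nat list list" where
  "D n k = D_stage n k (num_keys n k - 1)"

definition de_bruijn :: "nat \<Rightarrow> nat \<Rightarrow> nat list list \<Rightarrow> bool" where
  "de_bruijn n k ws \<longleftrightarrow>
     distinct ws \<and> set ws = words n k \<and>
     (\<forall>i \<tau> w. Suc i < length ws \<longrightarrow> ws ! i = \<tau> # w \<longrightarrow> (\<exists>\<sigma>. ws ! Suc i = w @ [\<sigma>])) \<and>
     (\<forall>\<tau> x. last ws = \<tau> # x \<longrightarrow> (\<exists>\<sigma>. hd ws = x @ [\<sigma>]))"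

lemma linorder_colex: "class.linorder colex_le colex_less"
proof -
  have irr: "\<not> colex_less u u" for u
    unfolding colex_less_def by (simp add: lexord_irreflexive)
  have tr: "colex_less u v \<Longrightarrow> colex_less v w \<Longrightarrow> colex_less u w" for u v w
    unfolding colex_less_def by (meson lexord_trans trans_less_than)
  have tot: "colex_less u v \<or> u = v \<or> colex_less v u" for u v
    using lexord_linear[of less_than "rev u" "rev v"] linorder_less_linear
    unfolding colex_less_def less_than_iff by (metis rev_rev_ident)
  show ?thesis
    by unfold_locales (use irr tr tot in \<open>unfold colex_le_def, blast+\<close>)
qed

lemma finite_key_words: "finite (key_words n k)"
proof -
  have "key_words n k \<subseteq> {w. set w \<subseteq> {..<k} \<and> length w = n}"
    by (auto simp: key_words_def words_def)
  then show ?thesis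
    using finite_lists_length_eq[of "{..<k}" n] finite_subset by blast
qed

lemma keys_ex1: "\<exists>!ks. sorted_wrt colex_less ks \<and> set ks = key_words n k"
proof -
  interpret colex: linorder colex_le colex_less
    by (rule linorder_colex)
  show ?thesis
    using colex.finite_sorted_distinct_unique[OF finite_key_words]
    by (simp add: colex.strict_sorted_iff conj_commute conj_left_commute)
qed

lemma keys_correct:
  "sorted_wrt colex_less (keys n k)" "set (keys n k) = key_words n k"
  "length (keys n k) = num_keys n k"
proof -
  interpret colex: linorder colex_le colex_less
    by (rule linorder_colex)
  show s: "sorted_wrt colex_less (keys n k)" and e: "set (keys n k) = key_words n k"
    using theI'[OF keys_ex1[of n k]] unfolding keys_def by auto
  show "length (keys n k) = num_keys n k"
    using s e unfolding num_keys_def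
    by (metis colex.strict_sorted_iff distinct_card)
qed

lemma decomposition:
  assumes "set u \<noteq> {0}" "u \<noteq> []"
  obtains l \<sigma> w where
    "u = replicate l 0 @ Suc \<sigma> # w"
    "first_of u = w @ replicate l 0 @ [Suc \<sigma>]"
    "attach_of u = \<sigma> # w @ replicate l 0"
proof -
  have "dropWhile ((=) 0) u \<noteq> []"
    using assms by (auto simp: dropWhile_eq_Nil_conv) (metis last_in_set)
  then obtain s w where sw: "dropWhile ((=) 0) u = s # w"
    by (cases "dropWhile ((=) 0) u") auto
  then have "s \<noteq> 0"
    using hd_dropWhile[of "(=) 0" u] by auto
  then obtain \<sigma> where \<sigma>: "s = Suc \<sigma>"
    by (cases s) auto
  have "takeWhile ((=) 0) u = replicate (leading_zeros u) 0"
    unfolding leading_zeros_def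
    by (rule replicate_length_same[symmetric]) (auto dest: set_takeWhileD)
  then have "u = replicate (leading_zeros u) 0 @ Suc \<sigma> # w"
    by (metis sw \<sigma> takeWhile_dropWhile_id)
  then show thesis
    using that sw \<sigma> by (simp add: first_of_def attach_of_def)
qed

lemma rotations_eq_rotate: "rotations w = range (\<lambda>i. rotate i w)"
proof
  show "rotations w \<subseteq> range (\<lambda>i. rotate i w)"
  proof
    fix v assume "v \<in> rotations w"
    then obtain x y where "w = x @ y" "v = y @ x"
      unfolding rotations_def by blast
    then have "v = rotate (length x) w"
      by (simp add: rotate_append)
    then show "v \<in> range (\<lambda>i. rotate i w)" by blast
  qed
  show "range (\<lambda>i. rotate i w) \<subseteq> rotations w"
  proof
    fix v assume "v \<in> range (\<lambda>i. rotate i w)"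
    then obtain i where "v = rotate i w" by blast
    then have "v = drop (i mod length w) w @ take (i mod length w) w"
      by (simp add: rotate_drop_take)
    then show "v \<in> rotations w"
      unfolding rotations_def by (metis (mono_tags, lifting) append_take_drop_id mem_Collect_eq)
  qed
qed

lemma inj_rotate: "rotate i u = rotate i v \<Longrightarrow> u = v"
proof (induction i arbitrary: u v)
  case (Suc i)
  have "rotate1 a = rotate1 b \<Longrightarrow> a = b" for a b :: "'a list"
    by (cases a; cases b) auto
  then show ?case
    using Suc.IH Suc.prems by (metis rotate_Suc)
qed simp

text \<open>The defining properties of the cycle of a word \<open>0\<^sup>l (\<sigma> + 1) w\<close>.\<close>

lemma cycle_of_correct:
  assumes u: "u = replicate l 0 @ Suc \<sigma> # w"
  shows "distinct (cycle_of u)" "set (cycle_of u) = rotations u"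
    "hd (cycle_of u) = w @ replicate l 0 @ [Suc \<sigma>]"
    "last (cycle_of u) = Suc \<sigma> # w @ replicate l 0"
    "Suc i < length (cycle_of u) \<Longrightarrow> cycle_of u ! Suc i = rotate1 (cycle_of u ! i)"
proof -
  define f where "f = first_of u"
  have tw: "takeWhile ((=) 0) u = replicate l 0" "dropWhile ((=) 0) u = Suc \<sigma> # w"
    unfolding u by (induction l) auto
  have f: "f = w @ replicate l 0 @ [Suc \<sigma>]"
    unfolding f_def first_of_def leading_zeros_def by (simp add: tw)
  have fu: "f = rotate (Suc l) u"
    using rotate_append[of "replicate l 0 @ [Suc \<sigma>]" w] by (simp add: u f)
  have len: "length f = length u" "0 < length u"
    by (simp_all add: fu u)
  define P where "P p \<longleftrightarrow> 0 < p \<and> rotate p f = f" for p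
  have "P (length f)" using len by (simp add: P_def)
  define p where "p = (LEAST p. P p)"
  have p: "0 < p" "rotate p f = f"
    using LeastI[of P, OF \<open>P (length f)\<close>] by (auto simp: p_def P_def)
  have pmin: "p \<le> q" if "0 < q" "rotate q f = f" for q
    using that unfolding p_def by (intro Least_le) (simp add: P_def)
  have mult: "rotate (p * q) f = f" for q
    by (induction q) (simp_all add: rotate_rotate[symmetric] p)
  have red: "rotate i f = rotate (i mod p) f" for i
  proof -
    have "rotate i f = rotate (i mod p + p * (i div p)) f" by simp
    also have "\<dots> = rotate (i mod p) (rotate (p * (i div p)) f)"
      by (simp only: rotate_rotate)
    finally show ?thesis by (simp add: mult)
  qed
  have uf: "u = rotate (p * Suc l - Suc l) f"
  proof (rule inj_rotate[of "Suc l"])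
    have "Suc l + (p * Suc l - Suc l) = p * Suc l"
      using p(1) by (cases p) auto
    then show "rotate (Suc l) u = rotate (Suc l) (rotate (p * Suc l - Suc l) f)"
      using fu[symmetric] mult by (metis rotate_rotate)
  qed
  have "range (\<lambda>i. rotate i u) = range (\<lambda>i. rotate i f)"
  proof
    show "range (\<lambda>i. rotate i u) \<subseteq> range (\<lambda>i. rotate i f)"
      unfolding image_subset_iff by (metis uf rotate_rotate rangeI)
    show "range (\<lambda>i. rotate i f) \<subseteq> range (\<lambda>i. rotate i u)"
      unfolding image_subset_iff by (metis fu rotate_rotate rangeI)
  qed
  also have "\<dots> = (\<lambda>i. rotate i f) ` {..<p}"
  proof
    show "range (\<lambda>i. rotate i f) \<subseteq> (\<lambda>i. rotate i f) ` {..<p}"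
    proof
      fix v assume "v \<in> range (\<lambda>i. rotate i f)"
      then obtain i where "v = rotate i f" by blast
      then have "v = rotate (i mod p) f" by (metis red)
      moreover have "i mod p \<in> {..<p}" using p(1) by simp
      ultimately show "v \<in> (\<lambda>i. rotate i f) ` {..<p}" by (rule image_eqI)
    qed
  qed blast
  finally have rots: "rotations u = (\<lambda>i. rotate i f) ` {..<p}"
    by (simp add: rotations_eq_rotate)
  have neq: "rotate i f \<noteq> rotate j f" if "i < j" "j < p" for i j
  proof
    assume "rotate i f = rotate j f"
    then have "rotate i f = rotate i (rotate (j - i) f)"
      using that by (simp add: rotate_rotate)
    then have "rotate (j - i) f = f" using inj_rotate by metis
    then show False using pmin[of "j - i"] that by simp
  qed
  have inj: "inj_on (\<lambda>i. rotate i f) {..<p}"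
    by (rule inj_onI) (metis neq lessThan_iff linorder_neqE_nat)
  have card: "card (rotations u) = p"
    unfolding rots using inj by (simp add: card_image)
  have C: "cycle_of u = map (\<lambda>i. rotate i f) [0..<p]"
    unfolding cycle_of_def card f_def ..
  show "distinct (cycle_of u)"
    using inj unfolding C by (simp add: distinct_map atLeast0LessThan)
  show "set (cycle_of u) = rotations u"
    unfolding C rots by (simp add: atLeast0LessThan)
  show "hd (cycle_of u) = w @ replicate l 0 @ [Suc \<sigma>]"
    unfolding C using p f by (simp add: hd_map)
  have "last (cycle_of u) = rotate (p - 1) f"
    unfolding C using p by (simp add: last_map)
  then have "rotate1 (last (cycle_of u)) = rotate (Suc (p - 1)) f"
    by simp
  also have "\<dots> = f"
    using p by (metis Suc_diff_1)
  also have "\<dots> = rotate1 (Suc \<sigma> # w @ replicate l 0)"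
    by (simp add: f)
  finally show "last (cycle_of u) = Suc \<sigma> # w @ replicate l 0"
    by (rule inj_rotate[of "Suc 0", unfolded rotate_Suc rotate0 id_apply])
  show "Suc i < length (cycle_of u) \<Longrightarrow> cycle_of u ! Suc i = rotate1 (cycle_of u ! i)"
    unfolding C by simp
qed

end

theory Submission
  imports Defs
begin

text \<open>Every rotation of \<open>0\<^sup>l \<sigma> w\<close> is colex-smaller than the same rotation of the key-word
  \<open>0\<^sup>l (\<sigma> + 1) w\<close>, hence than that key-word itself. So the attachment word \<open>\<sigma> w 0\<^sup>l\<close> lies on a
  cycle with a smaller key, which was inserted earlier. As \<open>\<sigma> w 0\<^sup>l\<close> and the last word
  \<open>(\<sigma> + 1) w 0\<^sup>l\<close> of the new cycle agree after the first symbol, the insertion preserves the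
  De Bruijn successor property, also cyclically. Finally, the cycles partition the set of all words.\<close>

interpretation colex: linorder colex_le colex_less
  by (rule linorder_colex)

text \<open>Reversal keeps the pointwise comparison, and the first position where the reversals
  differ decides. The detour is useful because pointwise comparison, unlike colex order, survives
  rotating both words by the same amount.\<close>

lemma colex_less_if_pointwise_le:
  assumes "list_all2 (\<le>) u v" "u \<noteq> v"
  shows "colex_less u v"
proof -
  have "(xs, ys) \<in> lexord less_than" if "list_all2 (\<le>) xs ys" "xs \<noteq> ys" for xs ys :: "nat list"
    using that by (induction rule: list_all2_induct) auto
  from this[of "rev u" "rev v"] show ?thesis
    using assms by (simp add: colex_less_def)
qed

lemma list_all2_rotate:
  "list_all2 P u v \<Longrightarrow> list_all2 P (rotate i u) (rotate i v)"
  by (simp add: rotate_drop_take list_all2_lengthD list_all2_appendI)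

lemma self_in_rotations: "w \<in> rotations w"
  unfolding rotations_def by force

lemma rotations_sym: "v \<in> rotations w \<Longrightarrow> w \<in> rotations v"
  unfolding rotations_def by auto

lemma rotations_trans:
  assumes "u \<in> rotations v" "v \<in> rotations w"
  shows "u \<in> rotations w"
  using assms unfolding rotations_eq_rotate by (auto simp: rotate_rotate)

lemma rotations_in_words:
  assumes "w \<in> words n k" "v \<in> rotations w"
  shows "v \<in> words n k"
  using assms unfolding words_def rotations_def by auto

text \<open>The colex-maximum of the finite rotation class of \<open>w\<close> works, since its
  rotations are again rotations of \<open>w\<close>. Together with \<open>key_words_eqI\<close> this
  makes the key-words a system of representatives of the rotation classes.\<close>

lemma ex_key_rotation:
  assumes "w \<in> words n k"
  obtains u where "u \<in> key_words n k" "w \<in> rotations u"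
proof -
  have "finite (words n k)"
    using finite_lists_length_eq[of "{..<k}" n] by (simp add: words_def conj_commute)
  then have fin: "finite (rotations w)"
    by (rule finite_subset[rotated]) (auto intro: rotations_in_words[OF assms])
  define u where "u = colex.Max (rotations w)"
  have u: "u \<in> rotations w" "v \<in> rotations w \<Longrightarrow> colex_le v u" for v
    unfolding u_def using fin self_in_rotations[of w] colex.Max_in colex.Max_ge by blast+
  then have "u \<in> key_words n k"
    unfolding key_words_def using rotations_in_words[OF assms] rotations_trans by blast
  then show thesis
    using that u(1) rotations_sym by blast
qed

lemma key_words_eqI:
  assumes "u \<in> key_words n k" "v \<in> key_words n k" "w \<in> rotations u" "w \<in> rotations v"
  shows "u = v"
  using assms unfolding key_words_def
  by (blast intro: colex.order.antisym rotations_sym rotations_trans)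

lemma key_in_key_words: "m < num_keys n k \<Longrightarrow> key n k m \<in> key_words n k"
  unfolding key_def using keys_correct[of n k] by (metis nth_mem)

lemma ex_key_index:
  assumes "u \<in> key_words n k"
  obtains m where "m < num_keys n k" "u = key n k m"
  using assms keys_correct[of n k] unfolding key_def by (metis in_set_conv_nth)

lemma key_less_iff:
  assumes "i < num_keys n k" "j < num_keys n k"
  shows "colex_less (key n k i) (key n k j) \<longleftrightarrow> i < j"
  using assms keys_correct[of n k] sorted_wrt_nth_less[of colex_less "keys n k"]
  unfolding key_def by (metis colex.less_asym colex.less_irrefl linorder_neqE_nat)

lemma rotations_replicate: "rotations (replicate n a) = {replicate n a}"
proof -
  have "rotate i (replicate n a) = replicate n a" for i
    by (rule nth_equalityI) (simp_all add: nth_rotate)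
  then show ?thesis by (simp add: rotations_eq_rotate)
qed

lemma zero_word_is_key: "k \<ge> 1 \<Longrightarrow> replicate n 0 \<in> key_words n k"
  by (auto simp: key_words_def rotations_replicate words_def colex_le_def)

lemma num_keys_pos: "k \<ge> 1 \<Longrightarrow> 0 < num_keys n k"
  by (metis zero_word_is_key ex_key_index gr_zeroI less_nat_zero_code)

text \<open>The zero word is pointwise below every word of its length, so its index \<open>m\<close>
  in the increasing list cannot be positive.\<close>

lemma key_0:
  assumes "k \<ge> 1"
  shows "key n k 0 = replicate n 0"
proof -
  obtain m where m: "m < num_keys n k" "replicate n 0 = key n k m"
    using zero_word_is_key[OF assms] ex_key_index by blast
  have "length (key n k 0) = n"
    using key_in_key_words[OF num_keys_pos[OF assms]] by (simp add: key_words_def words_def)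
  then have "list_all2 (\<le>) (replicate n 0) (key n k 0)"
    by (simp add: list_all2_conv_all_nth)
  then have "\<not> 0 < m"
    using colex_less_if_pointwise_le m key_less_iff[OF num_keys_pos[OF assms] m(1)]
    by (metis colex.less_asym colex.less_irrefl)
  then show ?thesis using m by simp
qed

lemma attach_in_smaller_cycle:
  assumes "u = replicate l 0 @ Suc \<sigma> # w" "u \<in> key_words n k"
  obtains z where "z \<in> key_words n k" "\<sigma> # w @ replicate l 0 \<in> rotations z" "colex_less z u"
proof -
  \<comment> \<open>Lowering the symbol in place makes \<open>v\<close> pointwise comparable with
    \<open>u\<close>; the attachment word is a rotation of \<open>v\<close>.\<close>
  define v where "v = replicate l 0 @ \<sigma> # w"
  have rot: "\<sigma> # w @ replicate l 0 \<in> rotations v"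
    unfolding v_def rotations_def by (metis (mono_tags, lifting) append_Cons mem_Collect_eq)
  have "u \<in> words n k"
    using assms(2) unfolding key_words_def by blast
  then have "v \<in> words n k"
    by (auto simp: v_def assms(1) words_def)
  then obtain z where z: "z \<in> key_words n k" "v \<in> rotations z"
    using ex_key_rotation by blast
  then obtain i where i: "z = rotate i v"
    using rotations_sym[OF z(2)] by (auto simp: rotations_eq_rotate)
  have "list_all2 (\<le>) v u" "v \<noteq> u"
    by (auto simp: v_def assms(1) list_all2_append list_all2_refl)
  \<comment> \<open>The rotation that takes \<open>v\<close> to its key \<open>z\<close> is applied
    to \<open>u\<close> as well; injectivity of \<open>rotate i\<close> keeps the inequality
    strict.\<close>
  then have "colex_less z (rotate i u)"
    unfolding i by (metis colex_less_if_pointwise_le list_all2_rotate inj_rotate)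
  moreover have "colex_le (rotate i u) u"
    using assms(2) by (auto simp: key_words_def rotations_eq_rotate)
  ultimately have "colex_less z u"
    by (rule colex.less_le_trans)
  then show thesis
    using that z rot rotations_trans by blast
qed

text \<open>For nonempty words this is the successor condition \<open>u = \<tau> # w\<close>,
  \<open>v = w @ [\<sigma>]\<close>, freed of quantifiers; \<open>overlap_ConsD\<close> translates
  back.\<close>

definition overlap :: "'a list \<Rightarrow> 'a list \<Rightarrow> bool" where
  "overlap u v \<longleftrightarrow> tl u = butlast v"

definition cyclic_overlap :: "'a list list \<Rightarrow> bool" where
  "cyclic_overlap ws \<longleftrightarrow> ws \<noteq> [] \<and> successively overlap ws \<and> overlap (last ws) (hd ws)"

lemma insert_after_split: "x \<notin> set xs \<Longrightarrow> insert_after x ys (xs @ x # zs) = xs @ x # ys @ zs"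
  by (induction xs) auto

lemma overlap_rotate1: "u \<noteq> [] \<Longrightarrow> overlap u (rotate1 u)"
  by (cases u) (auto simp: overlap_def)

lemma successively_overlap_cycle_of:
  assumes "u = replicate l 0 @ Suc \<sigma> # w"
  shows "successively overlap (cycle_of u)"
proof -
  have "cycle_of u ! i \<noteq> []" if "i < length (cycle_of u)" for i
    using nth_mem[OF that] unfolding cycle_of_correct(2)[OF assms]
    by (metis append_is_Nil_conv assms imageE list.distinct(1) rotate_is_Nil_conv rotations_eq_rotate)
  then show ?thesis
    unfolding successively_conv_nth
    using cycle_of_correct(5)[OF assms] overlap_rotate1 by (metis Suc_lessD)
qed

text \<open>Having the same tail as \<open>x\<close>, the word \<open>last ys\<close> overlaps
  exactly the words that \<open>x\<close> overlaps. It therefore takes over the old successor of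
  \<open>x\<close>: the next word or, if \<open>x\<close> was last, the first word of the
  list.\<close>

lemma cyclic_overlap_insert_after:
  assumes "cyclic_overlap ws" "x \<in> set ws" "successively overlap ys" "ys \<noteq> []"
    and "overlap x (hd ys)" "tl (last ys) = tl x"
  shows "cyclic_overlap (insert_after x ys ws)"
proof -
  obtain xs zs where ws: "ws = xs @ x # zs" "x \<notin> set xs"
    using split_list_first[OF assms(2)] by blast
  show ?thesis
    using assms unfolding ws insert_after_split[OF ws(2)]
    by (cases zs; cases xs)
      (auto simp: cyclic_overlap_def successively_append_iff successively_Cons overlap_def hd_append)
qed

text \<open>The description of the set carries the induction: it shows that the attachment word is
  already present and that the new cycle is disjoint from the list, which preserves
  distinctness.\<close>

lemma D_stage_invariant:
  assumes "k \<ge> 1" "m < num_keys n k"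
  shows "distinct (D_stage n k m) \<and> set (D_stage n k m) = (\<Union>i\<le>m. rotations (key n k i)) \<and>
    cyclic_overlap (D_stage n k m)"
  using assms(2)
proof (induction m)
  case 0
  show ?case
    by (simp add: key_0[OF assms(1)] rotations_replicate cyclic_overlap_def overlap_def
        butlast_conv_take tl_replicate)
next
  case (Suc m)
  define u where "u = key n k (Suc m)"
  have m: "m < num_keys n k" using Suc.prems by simp
  note IH = Suc.IH[OF m]
  have u: "u \<in> key_words n k"
    unfolding u_def by (rule key_in_key_words[OF Suc.prems])
  \<comment> \<open>A key with positive index lies strictly above the zero word, so
    \<open>decomposition\<close> applies to it.\<close>
  have "colex_less (replicate n 0) u"
    using key_less_iff[OF num_keys_pos[OF assms(1)] Suc.prems]
    by (simp add: u_def key_0[OF assms(1)])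
  moreover have "length u = n" using u by (simp add: key_words_def words_def)
  ultimately have nz: "set u \<noteq> {0}" "u \<noteq> []"
    by (metis colex.less_irrefl replicate_length_same singletonD,
        metis colex.less_irrefl list.size(3) replicate_0)
  obtain l \<sigma> w where d: "u = replicate l 0 @ Suc \<sigma> # w" "attach_of u = \<sigma> # w @ replicate l 0"
    using decomposition[OF nz] by metis
  note C = cycle_of_correct[OF d(1)]
  have ne: "cycle_of u \<noteq> []"
    using C(2) self_in_rotations[of u] by auto
  have mem: "attach_of u \<in> set (D_stage n k m)"
  proof -
    obtain z where z: "z \<in> key_words n k" "attach_of u \<in> rotations z" "colex_less z u"
      using attach_in_smaller_cycle[OF d(1) u] d(2) by metis
    obtain j where j: "j < num_keys n k" "z = key n k j"
      using ex_key_index[OF z(1)] by blast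
    \<comment> \<open>Keys are listed increasingly, so a smaller key has an index below
      \<open>Suc m\<close>.\<close>
    then have "j \<le> m"
      using z(3) key_less_iff[OF j(1) Suc.prems] by (simp add: u_def)
    then show ?thesis using IH z j by auto
  qed
  have disj: "set (D_stage n k m) \<inter> rotations u = {}"
  proof -
    have False if "i \<le> m" "v \<in> rotations (key n k i)" "v \<in> rotations u" for i v
    proof -
      have i: "i < num_keys n k" using that m by simp
      have "key n k i = u"
        using key_words_eqI[OF key_in_key_words[OF i] u that(2,3)] .
      then show False
        using key_less_iff[OF i Suc.prems] that(1) by (simp add: u_def)
    qed
    then show ?thesis using IH by blast
  qed
  obtain xs zs where ws: "D_stage n k m = xs @ attach_of u # zs" "attach_of u \<notin> set xs"
    using split_list_first[OF mem] by blast
  have ins: "D_stage n k (Suc m) = xs @ attach_of u # cycle_of u @ zs"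
    using ws by (simp add: u_def[symmetric] insert_after_split)
  have "distinct (D_stage n k (Suc m))"
    unfolding ins using conjunct1[OF IH, unfolded ws(1)] disj[unfolded ws(1)] C(1,2) by auto
  moreover have "set (D_stage n k (Suc m)) = set (D_stage n k m) \<union> rotations u"
    unfolding ins ws(1) using C(2) by auto
  then have "set (D_stage n k (Suc m)) = (\<Union>i\<le>Suc m. rotations (key n k i))"
    using IH by (simp add: atMost_Suc u_def Un_commute)
  \<comment> \<open>The block \<open>w @ replicate l 0\<close> is the tail of
    \<open>attach_of u\<close>, the front part of the first word of the new cycle and the tail of
    its last word.\<close>
  moreover have "cyclic_overlap (D_stage n k (Suc m))"
    using cyclic_overlap_insert_after[OF _ mem successively_overlap_cycle_of[OF d(1)] ne] IH C(3,4)
    by (simp add: u_def[symmetric] d(2) overlap_def butlast_append)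
  ultimately show ?case by blast
qed

lemma Union_rotations_key: "(\<Union>i<num_keys n k. rotations (key n k i)) = words n k"
proof
  show "(\<Union>i<num_keys n k. rotations (key n k i)) \<subseteq> words n k"
  proof (rule UN_least)
    fix i assume "i \<in> {..<num_keys n k}"
    then have "key n k i \<in> words n k"
      using key_in_key_words[of i n k] by (simp add: key_words_def)
    then show "rotations (key n k i) \<subseteq> words n k"
      using rotations_in_words by blast
  qed
  show "words n k \<subseteq> (\<Union>i<num_keys n k. rotations (key n k i))"
  proof
    fix w assume "w \<in> words n k"
    then obtain u where u: "u \<in> key_words n k" "w \<in> rotations u"
      by (rule ex_key_rotation)
    from u(1) obtain m where "m < num_keys n k" "u = key n k m"
      by (rule ex_key_index)
    with u(2) show "w \<in> (\<Union>i<num_keys n k. rotations (key n k i))" by blast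
  qed
qed

lemma overlap_ConsD: "overlap (\<tau> # w) v \<Longrightarrow> v \<noteq> [] \<Longrightarrow> \<exists>\<sigma>. v = w @ [\<sigma>]"
  unfolding overlap_def by (metis append_butlast_last_id list.sel(3))

theorem theorem2:
  fixes n k :: nat
  assumes "n \<ge> 1" and "k \<ge> 1"
  shows "de_bruijn n k (D n k)"
proof -
  have pos: "0 < num_keys n k" by (rule num_keys_pos[OF assms(2)])
  \<comment> \<open>Positivity rules out truncated subtraction, so the final stage covers all
    keys.\<close>
  then have "{..num_keys n k - 1} = {..<num_keys n k}" by auto
  then have D: "distinct (D n k)" "set (D n k) = words n k" "cyclic_overlap (D n k)"
    using D_stage_invariant[OF assms(2), of "num_keys n k - 1" n] pos Union_rotations_key[of n k]
    by (simp_all add: D_def)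
  \<comment> \<open>Here \<open>n \<ge> 1\<close> enters: only for nonempty words can
    \<open>overlap\<close> be read back as the successor condition.\<close>
  have ne: "v \<noteq> []" if "v \<in> set (D n k)" for v
    using that assms(1) D(2) by (auto simp: words_def)
  show ?thesis
    unfolding de_bruijn_def
  proof (intro conjI allI impI D(1,2))
    fix i \<tau> w assume "Suc i < length (D n k)" "D n k ! i = \<tau> # w"
    then show "\<exists>\<sigma>. D n k ! Suc i = w @ [\<sigma>]"
      using D(3) ne overlap_ConsD unfolding cyclic_overlap_def successively_conv_nth
      by (metis nth_mem)
  next
    fix \<tau> x assume "last (D n k) = \<tau> # x"
    then show "\<exists>\<sigma>. hd (D n k) = x @ [\<sigma>]"
      using D(3) ne overlap_ConsD unfolding cyclic_overlap_def by (metis hd_in_set)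
  qed
qed

end
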